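(* Let $G$ be an infinite abelian group, and let $C \subseteq G$ be a non-empty solid subset such that $S + C - C \neq G$ for every subset $S \subseteq G$ with $|S| < |G|$ (cardinalities). Then $C$ is a maximal supplement in $G$.
   Context: For subsets of $G$, $A + B=\{a+b\}$ and $A - B = \{a - b : a\in A, b\in B\}$. $C \subseteq G$ is a supplement for $W \subseteq G$ if the translates $c + W$, $c \in C$, are pairwise disjoint; it is a maximal supplement for $W$ if moreover no proper superset of $C$ is a supplement for $W$; $C$ is a maximal supplement in $G$ if it is a maximal supplement for some $W \subseteq G$. $C$ is solid if there is no set $D \supsetneq C$ with $D - D = C - C$. *)

theory Defs
  imports
    Main
    "HOL-Library.Set_Algebras"
    "HOL-Library.Disjoint_Sets"
    "HOL-Library.Equipollence"
begin

text \<open>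
  The ambient group is the whole type, of class \<open>ab_group_add\<close>. The sumset \<open>A + B\<close> and the
  translate \<open>c +o W\<close> come from \<^theory>\<open>HOL-Library.Set_Algebras\<close>. On sets \<open>A - B\<close> already
  denotes the set-theoretic difference, so the algebraic difference needs its own name.
\<close>

definition diffset :: "'a::ab_group_add set \<Rightarrow> 'a set \<Rightarrow> 'a set" where
  "diffset A B = {a - b | a b. a \<in> A \<and> b \<in> B}"

text \<open>
  Disjointness is that of the family indexed by \<open>c \<in> C\<close>: distinct elements of \<open>C\<close> must
  give disjoint translates, even if these translates happen to be equal as sets.
\<close>

definition supplement :: "'a::ab_group_add set \<Rightarrow> 'a set \<Rightarrow> bool" where
  "supplement C W \<longleftrightarrow> disjoint_family_on (\<lambda>c. c +o W) C"

definition maximal_supplement_for :: "'a::ab_group_add set \<Rightarrow> 'a set \<Rightarrow> bool" where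
  "maximal_supplement_for C W \<longleftrightarrow> supplement C W \<and> (\<forall>D. C \<subset> D \<longrightarrow> \<not> supplement D W)"

definition maximal_supplement :: "'a::ab_group_add set \<Rightarrow> bool" where
  "maximal_supplement C \<longleftrightarrow> (\<exists>W. maximal_supplement_for C W)"

definition solid :: "'a::ab_group_add set \<Rightarrow> bool" where
  "solid C \<longleftrightarrow> \<not> (\<exists>D. C \<subset> D \<and> diffset D D = diffset C C)"

end

theory Submission
  imports Defs
begin

text \<open>
  For each \<open>x \<notin> C\<close>, solidity yields \<open>c \<in> C\<close> with \<open>d = x - c \<notin> C - C\<close>. If \<open>W\<close> contains
  a pair \<open>w, w + d\<close>, then \<open>x + W\<close> meets \<open>c + W\<close>, so \<open>x\<close> cannot be added to \<open>C\<close>. Such pairs are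
  chosen by transfinite recursion along a well-order of \<open>G\<close> of minimal type; fewer than \<open>|G|\<close>
  elements precede each stage, so by the covering hypothesis the new pair can avoid creating
  a nonzero element of \<open>(W - W) \<inter> (C - C)\<close>.
\<close>

lemma diffset_iff: "z \<in> diffset A B \<longleftrightarrow> (\<exists>a\<in>A. \<exists>b\<in>B. z = a - b)"
  unfolding diffset_def by blast

lemma diffset_self_uminus_iff [simp]: "- z \<in> diffset A A \<longleftrightarrow> z \<in> diffset A A"
  unfolding diffset_iff by (metis minus_diff_eq minus_minus)

lemma diffset_self_minus_commute: "x - y \<in> diffset A A \<longleftrightarrow> y - x \<in> diffset A A"
  using diffset_self_uminus_iff[of "x - y" A] by simp

lemma supplement_iff:
  "supplement C W \<longleftrightarrow>
     (\<forall>c\<in>C. \<forall>c'\<in>C. \<forall>w\<in>W. \<forall>w'\<in>W. c + w = c' + w' \<longrightarrow> c = c')"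
  unfolding supplement_def disjoint_family_on_def elt_set_plus_def by blast

text \<open>If every \<open>x - c\<close> lay in \<open>C - C\<close>, then adjoining
  \<open>x\<close> to \<open>C\<close> would create no new difference, against solidity.
  Non-emptiness of \<open>C\<close> is what puts \<open>x - x = 0\<close> into
  \<open>C - C\<close>.\<close>

lemma solid_obtain_difference:
  assumes "solid C" "C \<noteq> {}" "x \<notin> C"
  obtains c where "c \<in> C" "x - c \<notin> diffset C C"
proof -
  have "diffset (insert x C) (insert x C) \<noteq> diffset C C"
    using assms unfolding solid_def by blast
  moreover have "diffset (insert x C) (insert x C) = diffset C C"
    if all: "\<forall>c\<in>C. x - c \<in> diffset C C"
  proof
    have "0 \<in> diffset C C"
      using \<open>C \<noteq> {}\<close> by (auto simp: diffset_iff)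
    moreover have "c - x \<in> diffset C C" if "c \<in> C" for c
      using that all diffset_self_minus_commute by blast
    moreover have "c - c' \<in> diffset C C" if "c \<in> C" "c' \<in> C" for c c'
      using that by (auto simp: diffset_iff)
    ultimately have "a - b \<in> diffset C C" if "a \<in> insert x C" "b \<in> insert x C" for a b
      using that all by (cases "a = x"; cases "b = x") auto
    then show "diffset (insert x C) (insert x C) \<subseteq> diffset C C"
      unfolding diffset_def[of "insert x C"] by blast
    show "diffset C C \<subseteq> diffset (insert x C) (insert x C)"
      unfolding diffset_def by blast
  qed
  ultimately show ?thesis using that by blast
qed

lemma lesspoll_iff_card_of_ordLess: "A \<prec> B \<longleftrightarrow> ordLess2 (card_of A) (card_of B)"
  unfolding lesspoll_def lepoll_def eqpoll_iff_card_of_ordIso card_of_ordLeq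
  by (meson not_ordLess_ordIso ordLeq_iff_ordLess_or_ordIso)

lemma Un_lesspoll_infinite:
  assumes "infinite C" "A \<prec> C" "B \<prec> C"
  shows "A \<union> B \<prec> C"
  using assms unfolding lesspoll_iff_card_of_ordLess by (rule card_of_Un_ordLess_infinite)

text \<open>A cardinal is an initial ordinal: each proper initial segment of
  \<open>card_of UNIV\<close> is strictly smaller than the whole. Removing the diagonal gives the
  strict order.\<close>

lemma exists_wf_total_small_segments:
  obtains R :: "('a \<times> 'a) set"
  where "wf R" "total R" "\<And>x. {y. (y, x) \<in> R} \<prec> (UNIV :: 'a set)"
proof
  let ?r = "card_of (UNIV :: 'a set)"
  have wo: "Well_order ?r" by (rule card_of_Well_order)
  then show "wf (?r - Id)"
    by (simp add: well_order_on_def)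
  show "total (?r - Id)"
    using wo by (simp add: Field_card_of well_order_on_def linear_order_on_def)
  fix x :: 'a
  have "{y. (y, x) \<in> ?r - Id} = underS ?r x"
    by (auto simp: underS_def)
  then show "{y. (y, x) \<in> ?r - Id} \<prec> (UNIV :: 'a set)"
    using card_of_underS[OF card_of_Card_order, of x "UNIV :: 'a set"]
    unfolding lesspoll_iff_card_of_ordLess Field_card_of by simp
qed

text \<open>Sparseness of \<open>W\<close> will make \<open>C\<close> a supplement, and the
  prescribed differences will make it maximal. The case \<open>d x = 0\<close> is for indices that
  ask for no difference.\<close>

lemma exists_sparse_set_with_differences:
  fixes C :: "'a::ab_group_add set" and d :: "'a \<Rightarrow> 'a"
  assumes inf: "infinite (UNIV :: 'a set)"
    and small: "\<And>S :: 'a set. S \<prec> (UNIV :: 'a set) \<Longrightarrow> diffset (S + C) C \<noteq> UNIV"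
    and d: "\<And>x. d x = 0 \<or> d x \<notin> diffset C C"
  obtains W where "\<And>w w'. w \<in> W \<Longrightarrow> w' \<in> W \<Longrightarrow> w - w' \<in> diffset C C \<Longrightarrow> w = w'"
    and "\<And>x. \<exists>w\<in>W. w + d x \<in> W"
proof -
  obtain R :: "('a \<times> 'a) set" where R: "wf R" "total R"
    and seg: "\<And>x. {y. (y, x) \<in> R} \<prec> (UNIV :: 'a set)"
    using exists_wf_total_small_segments by blast
  define P where "P f y = {f y, f y + d y}" for f :: "'a \<Rightarrow> 'a" and y
  \<comment> \<open>The pair \<open>w\<close>, \<open>w + d x\<close> is compared only with pairs
    chosen at stages before \<open>x\<close>, so \<open>good f x\<close> depends on \<open>f\<close>
    only below \<open>x\<close>, as well-founded recursion requires.\<close>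
  define good where "good f x w \<longleftrightarrow>
    (\<forall>y. (y, x) \<in> R \<longrightarrow> (\<forall>s\<in>P f y. w - s \<notin> diffset C C \<and> w + d x - s \<notin> diffset C C))"
    for f x w
  have "\<exists>w. good f x w" for f x
  proof -
    let ?U = "{y. (y, x) \<in> R}"
    let ?S = "f ` ?U \<union> (\<lambda>y. f y + d y) ` ?U"
    have img: "g ` A \<prec> (UNIV :: 'a set)" if "A \<prec> (UNIV :: 'a set)" for g :: "'a \<Rightarrow> 'a" and A
      using image_lepoll that by (rule lesspoll_trans1)
    \<comment> \<open>Since \<open>w + d x - s = w - (s - d x)\<close>, adding the shifted copy of
      \<open>?S\<close> turns the conditions on both members of the pair into one condition on
      \<open>w\<close>.\<close>
    have "?S \<union> (\<lambda>s. s - d x) ` ?S \<prec> (UNIV :: 'a set)"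
      by (intro Un_lesspoll_infinite inf img seg)
    then obtain w where "w \<notin> diffset ((?S \<union> (\<lambda>s. s - d x) ` ?S) + C) C"
      using small by blast
    then have w: "w \<noteq> s + c - c'" if "s \<in> ?S \<union> (\<lambda>s. s - d x) ` ?S" "c \<in> C" "c' \<in> C" for s c c'
      using that unfolding diffset_iff by (blast intro: set_plus_intro)
    have "w - s \<notin> diffset C C \<and> w + d x - s \<notin> diffset C C" if "s \<in> ?S" for s
    proof -
      have "w - s \<noteq> c - c' \<and> w + d x - s \<noteq> c - c'" if "c \<in> C" "c' \<in> C" for c c'
        using w[of s c c'] w[of "s - d x" c c'] that \<open>s \<in> ?S\<close>
        by (auto simp: algebra_simps)
      then show ?thesis by (auto simp: diffset_iff)
    qed
    then have "good f x w"
      unfolding good_def P_def by blast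
    then show ?thesis ..
  qed
  then have "\<exists>f. \<forall>x. good f x (f x)"
    by (intro dependent_wf_choice[OF R(1)]) (simp_all add: good_def P_def)
  then obtain f where f: "\<And>x. good f x (f x)" by blast
  have new: "w - s \<notin> diffset C C" if "(y, x) \<in> R" "w \<in> P f x" "s \<in> P f y" for x y w s
    using f[of x] that unfolding good_def P_def[of f x] by blast
  show thesis
  proof
    fix w w' assume "w \<in> (\<Union>x. P f x)" "w' \<in> (\<Union>x. P f x)" and diff: "w - w' \<in> diffset C C"
    then obtain x y where xy: "w \<in> P f x" "w' \<in> P f y" by blast
    \<comment> \<open>By symmetry of \<open>C - C\<close>, neither stage can precede the other, so
      both points belong to one pair. Their difference is then \<open>0\<close> or, up to sign,
      \<open>d x\<close>, which lies in \<open>C - C\<close> only if it is \<open>0\<close>.\<close>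
    have "(y, x) \<notin> R" "(x, y) \<notin> R"
      using new xy diff diffset_self_minus_commute by blast+
    then have "x = y" using \<open>total R\<close> by (auto simp: total_on_def)
    with xy diff d[of x] show "w = w'"
      by (auto simp: P_def)
  next
    fix x show "\<exists>w\<in>\<Union>x. P f x. w + d x \<in> (\<Union>x. P f x)"
      by (auto simp: P_def)
  qed
qed

theorem theorem5p3:
  fixes C :: "'a::ab_group_add set"
  assumes "infinite (UNIV :: 'a set)"
    and "C \<noteq> {}"
    and "solid C"
    and "\<And>S :: 'a set. S \<prec> (UNIV :: 'a set) \<Longrightarrow> diffset (S + C) C \<noteq> UNIV"
  shows "maximal_supplement C"
proof -
  have "\<forall>x. \<exists>c. x \<notin> C \<longrightarrow> c \<in> C \<and> x - c \<notin> diffset C C"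
    using solid_obtain_difference[OF assms(3,2)] by metis
  then obtain c where c: "\<And>x. x \<notin> C \<Longrightarrow> c x \<in> C \<and> x - c x \<notin> diffset C C"
    by metis
  \<comment> \<open>For \<open>x\<close> in \<open>C\<close> nothing has to be blocked; the value
    \<open>0\<close> lets the pair collapse to a single point.\<close>
  define d where "d x = (if x \<in> C then 0 else x - c x)" for x
  have "d x = 0 \<or> d x \<notin> diffset C C" for x
    using c by (simp add: d_def)
  then obtain W where W: "\<And>w w'. w \<in> W \<Longrightarrow> w' \<in> W \<Longrightarrow> w - w' \<in> diffset C C \<Longrightarrow> w = w'"
    and Wd: "\<And>x. \<exists>w\<in>W. w + d x \<in> W"
    using exists_sparse_set_with_differences[OF assms(1,4)] by metis
  have "supplement C W"
    unfolding supplement_iff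
  proof (intro ballI impI)
    fix a b w w' assume *: "a \<in> C" "b \<in> C" "w \<in> W" "w' \<in> W" "a + w = b + w'"
    \<comment> \<open>A common point of two translates turns a difference in \<open>W\<close> into
      one in \<open>C - C\<close>, where sparseness applies.\<close>
    then have "w - w' = b - a" by (simp add: algebra_simps)
    with * have "w = w'" using W[of w w'] by (auto simp: diffset_iff)
    with * show "a = b" by simp
  qed
  moreover have "\<not> supplement D W" if CD: "C \<subset> D" for D
  proof
    assume D: "supplement D W"
    obtain x where x: "x \<in> D" "x \<notin> C" using CD by blast
    obtain w where w: "w \<in> W" "w + d x \<in> W" using Wd by blast
    have "x + w = c x + (w + d x)" using x by (simp add: d_def)
    moreover have "c x \<in> D" using c x CD by blast
    ultimately have "x = c x"
      using D w x(1) unfolding supplement_iff by blast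
    then show False using c x by metis
  qed
  ultimately show ?thesis
    unfolding maximal_supplement_def maximal_supplement_for_def by blast
qed

end
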